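(* For $z\in\mathbb C$ let $$X(z)=\frac{|z|-|z+1|+1}{1+|z|+|z+1|},\quad Y(z)=\frac{|z+1|-|z|+1}{1+|z|+|z+1|},\quad Z(z)=\frac{|z|+|z+1|-1}{1+|z|+|z+1|},$$ and let $g$ be the Riemannian metric $$g=\frac{|dz|^2}{2|z||z+1|(1+|z|+|z+1|)}\quad\text{on }\mathbb C\setminus\{0,-1\}.$$ Then the map $$z\mapsto\bigl(\sqrt{X(z)},\sqrt{Y(z)},\sqrt{Z(z)}\bigr)$$ restricted to the open upper half-plane (respectively, to the open lower half-plane), equipped with $g$, is an isometric diffeomorphism onto the intersection of the unit $2$-sphere in $\mathbb R^3$ with the positive open octant $\{(x,y,z)\in\mathbb R^3:x,y,z>0\}$, equipped with the standard round metric.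
   Context: $|dz|^2=dx^2+dy^2$ for $z=x+iy$. The standard round metric on the unit sphere is the one induced from the Euclidean metric of $\mathbb R^3$. *)

theory Defs
  imports "HOL-Analysis.Analysis"
begin

section \<open>Smooth maps and diffeomorphisms between subsets of Euclidean spaces\<close>

text \<open>
  On an open subset of a Euclidean space: a map is of class \<open>C\<^sup>0\<close> if it is continuous, and of class
  \<open>C\<^bsup>k+1\<^esup>\<close> if it is (Frechet) differentiable and all its directional derivatives are of class
  \<open>C\<^sup>k\<close>. Since the source is finite dimensional, the latter means that the Frechet derivative,
  as an operator-valued map, is of class \<open>C\<^sup>k\<close>.
\<close>

primrec C_k_on :: "nat \<Rightarrow> 'a::euclidean_space set \<Rightarrow> ('a \<Rightarrow> 'b::real_normed_vector) \<Rightarrow> bool" where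
  "C_k_on 0 U f \<longleftrightarrow> continuous_on U f"
| "C_k_on (Suc k) U f \<longleftrightarrow>
     (\<forall>x\<in>U. f differentiable (at x)) \<and>
     (\<forall>v. C_k_on k U (\<lambda>x. frechet_derivative f (at x) v))"

definition C_infinity_on :: "'a::euclidean_space set \<Rightarrow> ('a \<Rightarrow> 'b::real_normed_vector) \<Rightarrow> bool" where
  "C_infinity_on U f \<longleftrightarrow> open U \<and> (\<forall>k. C_k_on k U f)"

text \<open>
  On an arbitrary subset \<open>S\<close> (such as an embedded submanifold) a map is smooth if it locally extends
  to a smooth map on an open set of the ambient space.
\<close>

definition smooth_map_on :: "'a::euclidean_space set \<Rightarrow> ('a \<Rightarrow> 'b::real_normed_vector) \<Rightarrow> bool" where
  "smooth_map_on S f \<longleftrightarrow>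
     (\<forall>x\<in>S. \<exists>W h. x \<in> W \<and> C_infinity_on W h \<and> (\<forall>y\<in>S \<inter> W. h y = f y))"

definition diffeomorphism_onto ::
    "'a::euclidean_space set \<Rightarrow> 'b::euclidean_space set \<Rightarrow> ('a \<Rightarrow> 'b) \<Rightarrow> bool" where
  "diffeomorphism_onto S T f \<longleftrightarrow>
     bij_betw f S T \<and> smooth_map_on S f \<and> smooth_map_on T (inv_into S f)"


section \<open>Riemannian metrics and isometries\<close>

text \<open>
  A metric assigns to each point \<open>p\<close> a bilinear form on the ambient vector space. On an open set
  the ambient space is the tangent space; on a submanifold only the values on pairs of
  vectors tangent at \<open>p\<close> are relevant.
\<close>

type_synonym 'a metric_field = "'a \<Rightarrow> 'a \<Rightarrow> 'a \<Rightarrow> real"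

definition riemannian_metric_on :: "'a::euclidean_space set \<Rightarrow> 'a metric_field \<Rightarrow> bool" where
  "riemannian_metric_on U g \<longleftrightarrow>
     open U \<and>
     (\<forall>p\<in>U. bilinear (g p) \<and> (\<forall>v w. g p v w = g p w v) \<and> (\<forall>v. v \<noteq> 0 \<longrightarrow> 0 < g p v v)) \<and>
     (\<forall>v w. C_infinity_on U (\<lambda>p. g p v w))"

definition pullback_metric ::
    "('a::euclidean_space \<Rightarrow> 'b::euclidean_space) \<Rightarrow> 'b metric_field \<Rightarrow> 'a metric_field" where
  "pullback_metric f h p v w =
     h (f p) (frechet_derivative f (at p) v) (frechet_derivative f (at p) w)"

text \<open>
  Here \<open>U\<close> is an open set with metric \<open>g\<close>, and \<open>T\<close> is a submanifold with metric \<open>h\<close>. For a smooth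
  map from \<open>U\<close> into \<open>T\<close>, the derivative at \<open>p\<close> takes values in the tangent space of \<open>T\<close> at \<open>f p\<close>,
  so the pullback only evaluates \<open>h\<close> on tangent vectors.
\<close>

definition isometric_diffeomorphism ::
    "'a::euclidean_space set \<Rightarrow> 'a metric_field \<Rightarrow> 'b::euclidean_space set \<Rightarrow> 'b metric_field
      \<Rightarrow> ('a \<Rightarrow> 'b) \<Rightarrow> bool" where
  "isometric_diffeomorphism U g T h f \<longleftrightarrow>
     open U \<and> diffeomorphism_onto U T f \<and>
     (\<forall>p\<in>U. \<forall>v w. pullback_metric f h p v w = g p v w)"

text \<open>The metric induced on a submanifold by the Euclidean metric of the ambient space.\<close>

definition induced_metric :: "'a::euclidean_space metric_field" where
  "induced_metric p v w = v \<bullet> w"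


section \<open>The map to the sphere\<close>

definition X :: "complex \<Rightarrow> real" where
  "X z = (cmod z - cmod (z + 1) + 1) / (1 + cmod z + cmod (z + 1))"

definition Y :: "complex \<Rightarrow> real" where
  "Y z = (cmod (z + 1) - cmod z + 1) / (1 + cmod z + cmod (z + 1))"

definition Z :: "complex \<Rightarrow> real" where
  "Z z = (cmod z + cmod (z + 1) - 1) / (1 + cmod z + cmod (z + 1))"

definition sphere_map :: "complex \<Rightarrow> real ^ 3" where
  "sphere_map z = vector [sqrt (X z), sqrt (Y z), sqrt (Z z)]"

text \<open>The real inner product of \<open>complex\<close> is the bilinear form of \<open>|dz|\<^sup>2 = dx\<^sup>2 + dy\<^sup>2\<close>.\<close>

definition g_metric :: "complex metric_field" where
  "g_metric z v w =
     (v \<bullet> w) / (2 * cmod z * cmod (z + 1) * (1 + cmod z + cmod (z + 1)))"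

definition positive_octant :: "(real ^ 3) set" where
  "positive_octant = {p. 0 < p $ 1 \<and> 0 < p $ 2 \<and> 0 < p $ 3}"

end

theory Submission
  imports Defs
begin

text \<open>
  With \<open>a = |z|\<close>, \<open>b = |z + 1|\<close> and \<open>s = 1 + a + b\<close>, each of \<open>X, Y, Z\<close> is a quotient \<open>A / s\<close> of functions
  of \<open>a\<close> and \<open>b\<close>, so the pulled back metric is a quarter of the sum of the terms
  \<open>X (dA / A - ds / s)\<^sup>2\<close>. This simplifies to
  \<open>((da - db)\<^sup>2 / (1 - (a - b)\<^sup>2) + (da + db)\<^sup>2 / ((a + b)\<^sup>2 - 1)) / (2 s)\<close>, the metric \<open>g\<close> in elliptic
  coordinates. By Heron's formula the product of the two denominators is \<open>4 (Im z)\<^sup>2\<close>, which also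
  makes \<open>X, Y, Z\<close> positive off the real line and allows one to solve for \<open>Im z\<close> up to sign.
\<close>

section \<open>Closure properties of smooth functions\<close>

text \<open>On an open set the derivative at a point depends only on nearby values, so behaviour
  outside \<open>U\<close> never enters the induction on the order.\<close>

lemma C_k_on_cong:
  fixes f g :: "'a::euclidean_space \<Rightarrow> 'b::real_normed_vector"
  assumes "open U" and "\<And>x. x \<in> U \<Longrightarrow> f x = g x" and "C_k_on k U f"
  shows "C_k_on k U g"
  using assms(2,3)
proof (induction k arbitrary: f g)
  case 0
  then show ?case using continuous_on_cong by (metis C_k_on.simps(1))
next
  case (Suc k)
  have D: "(g has_derivative frechet_derivative f (at x)) (at x)" if "x \<in> U" for x
    using Suc.prems that \<open>open U\<close> has_derivative_transform_within_open
    by (metis C_k_on.simps(2) frechet_derivative_works)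
  then have eq: "frechet_derivative f (at x) v = frechet_derivative g (at x) v" if "x \<in> U" for x v
    using that frechet_derivative_at by metis
  have "C_k_on k U (\<lambda>x. frechet_derivative g (at x) v)" for v
    by (rule Suc.IH[of "\<lambda>x. frechet_derivative f (at x) v"]) (use eq Suc.prems in auto)
  with D show ?case by (auto simp: differentiable_def)
qed

text \<open>\<open>frechet_derivative\<close> is a choice operator. By uniqueness of derivatives, an
  explicit formula that is valid only on \<open>U\<close> may stand in for it, and the closure rules
  compute with such formulas.\<close>

lemma C_k_on_SucI:
  fixes f :: "'a::euclidean_space \<Rightarrow> 'b::real_normed_vector"
  assumes "open U" and "\<And>x. x \<in> U \<Longrightarrow> (f has_derivative f' x) (at x)"
    and "\<And>v. C_k_on k U (\<lambda>x. f' x v)"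
  shows "C_k_on (Suc k) U f"
proof -
  have "f' x v = frechet_derivative f (at x) v" if "x \<in> U" for x v
    using that assms(2) frechet_derivative_at by metis
  then have "C_k_on k U (\<lambda>x. frechet_derivative f (at x) v)" for v
    using C_k_on_cong[OF \<open>open U\<close> _ assms(3)] by auto
  with assms(2) show ?thesis by (auto simp: differentiable_def)
qed

text \<open>The product rule at order \<open>Suc k\<close> contains the undifferentiated factors,
  which therefore have to be available at order \<open>k\<close>.\<close>

lemma C_k_on_SucD:
  fixes f :: "'a::euclidean_space \<Rightarrow> 'b::real_normed_vector"
  assumes "C_k_on (Suc k) U f"
  shows "C_k_on k U f"
  using assms
proof (induction k arbitrary: f)
  case 0
  then show ?case
    by (auto intro!: continuous_at_imp_continuous_on differentiable_imp_continuous_within)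
next
  case (Suc k)
  then show ?case by (metis C_k_on.simps(2))
qed

lemma C_k_on_has_derivative:
  assumes "C_k_on (Suc k) U f" "x \<in> U"
  shows "(f has_derivative frechet_derivative f (at x)) (at x)"
  using assms by (simp add: frechet_derivative_works)

lemma C_k_on_const: "open U \<Longrightarrow> C_k_on k U (\<lambda>x. c)"
proof (induction k arbitrary: c)
  case (Suc k)
  show ?case by (rule C_k_on_SucI[where f' = "\<lambda>_ _. 0"]) (use Suc in auto)
qed auto

lemma C_k_on_linear:
  assumes "open U" "bounded_linear f"
  shows "C_k_on k U f"
proof (cases k)
  case 0
  then show ?thesis using assms linear_continuous_on by auto
next
  case (Suc n)
  have "C_k_on (Suc n) U f"
    by (rule C_k_on_SucI[where f' = "\<lambda>_. f"])
      (use assms bounded_linear_imp_has_derivative C_k_on_const in auto)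
  then show ?thesis using Suc by simp
qed

lemma C_k_on_add:
  assumes "open U" "C_k_on k U f" "C_k_on k U g"
  shows "C_k_on k U (\<lambda>x. f x + g x)"
  using assms(2,3)
proof (induction k arbitrary: f g)
  case 0
  then show ?case by (auto intro: continuous_intros)
next
  case (Suc k)
  show ?case
    by (rule C_k_on_SucI[OF \<open>open U\<close> has_derivative_add[OF
          C_k_on_has_derivative[OF Suc.prems(1)] C_k_on_has_derivative[OF Suc.prems(2)]]])
      (use Suc in auto)
qed

lemma C_k_on_scaleR:
  assumes "open U" "C_k_on k U f" "C_k_on k U g"
  shows "C_k_on k U (\<lambda>x. f x *\<^sub>R g x)"
  using assms(2,3)
proof (induction k arbitrary: f g)
  case 0
  then show ?case by (auto intro: continuous_intros)
next
  case (Suc k)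
  show ?case
  proof (rule C_k_on_SucI[OF \<open>open U\<close> has_derivative_scaleR[OF
          C_k_on_has_derivative[OF Suc.prems(1)] C_k_on_has_derivative[OF Suc.prems(2)]]])
    show "C_k_on k U (\<lambda>x. f x *\<^sub>R frechet_derivative g (at x) v
        + frechet_derivative f (at x) v *\<^sub>R g x)" for v
      using Suc.IH Suc.prems C_k_on_SucD[OF Suc.prems(1)] C_k_on_SucD[OF Suc.prems(2)]
      by (intro C_k_on_add \<open>open U\<close>) auto
  qed auto
qed

text \<open>The derivative \<open>-f' / f^2\<close> contains the reciprocal itself, but only order
  \<open>k\<close> of it is required, which the induction hypothesis supplies. The nested scalings
  in \<open>?D\<close> bring it into the shape of the product rule.\<close>

lemma C_k_on_inverse:
  fixes f :: "'a::euclidean_space \<Rightarrow> real"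
  assumes "open U" "\<And>x. x \<in> U \<Longrightarrow> f x \<noteq> 0" "C_k_on k U f"
  shows "C_k_on k U (\<lambda>x. inverse (f x))"
  using assms(3)
proof (induction k)
  case 0
  then show ?case using assms(2) by (auto intro: continuous_intros)
next
  case (Suc k)
  let ?D = "\<lambda>x v. inverse (f x) *\<^sub>R (inverse (f x) *\<^sub>R (-1) *\<^sub>R frechet_derivative f (at x) v)"
  show ?case
  proof (rule C_k_on_SucI[OF \<open>open U\<close>, where f' = ?D])
    show "((\<lambda>x. inverse (f x)) has_derivative ?D x) (at x)" if "x \<in> U" for x
      using Deriv.has_derivative_inverse[OF assms(2)[OF that] C_k_on_has_derivative[OF Suc.prems that]]
      by (simp add: mult_ac)
    have "C_k_on k U (\<lambda>x. inverse (f x))" using Suc C_k_on_SucD by blast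
    then show "C_k_on k U (\<lambda>x. ?D x v)" for v
      using Suc.prems by (intro C_k_on_scaleR C_k_on_const \<open>open U\<close>) auto
  qed
qed

text \<open>The same bootstrapping works for \<open>f' / (2 * sqrt f)\<close>; positivity keeps
  \<open>f\<close> away from the singularity of the root.\<close>

lemma C_k_on_sqrt:
  fixes f :: "'a::euclidean_space \<Rightarrow> real"
  assumes "open U" "\<And>x. x \<in> U \<Longrightarrow> 0 < f x" "C_k_on k U f"
  shows "C_k_on k U (\<lambda>x. sqrt (f x))"
  using assms(3)
proof (induction k)
  case 0
  then show ?case by (auto intro: continuous_intros)
next
  case (Suc k)
  let ?D = "\<lambda>x v. inverse (sqrt (f x)) *\<^sub>R ((1/2) *\<^sub>R frechet_derivative f (at x) v)"
  show ?case
  proof (rule C_k_on_SucI[OF \<open>open U\<close>, where f' = ?D])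
    show "((\<lambda>x. sqrt (f x)) has_derivative ?D x) (at x)" if "x \<in> U" for x
      using has_derivative_real_sqrt[OF assms(2)[OF that] C_k_on_has_derivative[OF Suc.prems that]]
      by (simp add: field_simps)
    have "C_k_on k U (\<lambda>x. sqrt (f x))" using Suc C_k_on_SucD by blast
    then have "C_k_on k U (\<lambda>x. inverse (sqrt (f x)))"
      using assms(2) by (intro C_k_on_inverse \<open>open U\<close>) (auto dest: order_less_imp_not_eq2)
    then show "C_k_on k U (\<lambda>x. ?D x v)" for v
      using Suc.prems by (intro C_k_on_scaleR C_k_on_const \<open>open U\<close>) auto
  qed
qed

section \<open>Closure rules for infinite order and for the target spaces in use\<close>

lemma C_infinity_on_const: "open U \<Longrightarrow> C_infinity_on U (\<lambda>x. c)"
  by (simp add: C_infinity_on_def C_k_on_const)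

lemma C_infinity_on_linear: "open U \<Longrightarrow> bounded_linear f \<Longrightarrow> C_infinity_on U f"
  by (simp add: C_infinity_on_def C_k_on_linear)

lemma C_infinity_on_add:
  "C_infinity_on U f \<Longrightarrow> C_infinity_on U g \<Longrightarrow> C_infinity_on U (\<lambda>x. f x + g x)"
  by (simp add: C_infinity_on_def C_k_on_add)

lemma C_infinity_on_scaleR:
  "C_infinity_on U f \<Longrightarrow> C_infinity_on U g \<Longrightarrow> C_infinity_on U (\<lambda>x. f x *\<^sub>R g x)"
  by (simp add: C_infinity_on_def C_k_on_scaleR)

lemma C_infinity_on_mult:
  fixes f g :: "'a::euclidean_space \<Rightarrow> real"
  shows "C_infinity_on U f \<Longrightarrow> C_infinity_on U g \<Longrightarrow> C_infinity_on U (\<lambda>x. f x * g x)"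
  using C_infinity_on_scaleR by fastforce

lemma C_infinity_on_diff:
  fixes f g :: "'a::euclidean_space \<Rightarrow> 'b::real_normed_vector"
  assumes "C_infinity_on U f" "C_infinity_on U g"
  shows "C_infinity_on U (\<lambda>x. f x - g x)"
proof -
  have "open U" using assms(1) by (simp add: C_infinity_on_def)
  then have "C_infinity_on U (\<lambda>x. f x + (-1) *\<^sub>R g x)"
    using assms by (intro C_infinity_on_add C_infinity_on_scaleR C_infinity_on_const)
  then show ?thesis by simp
qed

lemma C_infinity_on_power:
  fixes f :: "'a::euclidean_space \<Rightarrow> real"
  assumes "C_infinity_on U f"
  shows "C_infinity_on U (\<lambda>x. f x ^ n)"
proof (induction n)
  case 0
  then show ?case using assms by (simp add: C_infinity_on_def C_k_on_const)
next
  case (Suc n)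
  then show ?case using C_infinity_on_mult[OF assms] by simp
qed

lemma C_infinity_on_divide:
  fixes f g :: "'a::euclidean_space \<Rightarrow> real"
  assumes "C_infinity_on U f" "C_infinity_on U g" "\<And>x. x \<in> U \<Longrightarrow> g x \<noteq> 0"
  shows "C_infinity_on U (\<lambda>x. f x / g x)"
  using assms unfolding divide_inverse
  by (intro C_infinity_on_mult) (auto simp: C_infinity_on_def C_k_on_inverse)

lemma C_infinity_on_sqrt:
  fixes f :: "'a::euclidean_space \<Rightarrow> real"
  assumes "C_infinity_on U f" "\<And>x. x \<in> U \<Longrightarrow> 0 < f x"
  shows "C_infinity_on U (\<lambda>x. sqrt (f x))"
  using assms by (simp add: C_infinity_on_def C_k_on_sqrt)

lemma C_infinity_on_cmod:
  assumes "C_infinity_on U (\<lambda>x. Re (f x))" "C_infinity_on U (\<lambda>x. Im (f x))"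
    and "\<And>x. x \<in> U \<Longrightarrow> f x \<noteq> 0"
  shows "C_infinity_on U (\<lambda>x. cmod (f x))"
  unfolding cmod_def using assms
  by (intro C_infinity_on_sqrt C_infinity_on_add C_infinity_on_power)
    (auto simp: complex_eq_iff sum_power2_gt_zero_iff)

lemma C_infinity_on_Complex:
  assumes "C_infinity_on U f" "C_infinity_on U g"
  shows "C_infinity_on U (\<lambda>x. Complex (f x) (g x))"
proof -
  have "open U" using assms(1) by (simp add: C_infinity_on_def)
  then have "C_infinity_on U (\<lambda>x. f x *\<^sub>R 1 + g x *\<^sub>R \<i>)"
    using assms by (intro C_infinity_on_add C_infinity_on_scaleR C_infinity_on_const)
  then show ?thesis by (simp add: Complex_eq scaleR_conv_of_real mult.commute)
qed

text \<open>A sum of scaled constant vectors is covered by the rules for sums and scalings, both for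
  smoothness and for derivatives.\<close>

lemma vector_3_expand:
  "vector [a, b, c] = a *\<^sub>R axis 1 1 + b *\<^sub>R axis 2 1 + c *\<^sub>R (axis 3 1 :: real ^ 3)"
  by (simp add: vec_eq_iff forall_3 axis_def)

lemma C_infinity_on_vector_3:
  assumes "C_infinity_on U f" "C_infinity_on U g" "C_infinity_on U h"
  shows "C_infinity_on U (\<lambda>x. vector [f x, g x, h x] :: real ^ 3)"
proof -
  have "open U" using assms(1) by (simp add: C_infinity_on_def)
  then show ?thesis
    unfolding vector_3_expand
    using assms by (intro C_infinity_on_add C_infinity_on_scaleR C_infinity_on_const)
qed

lemma inner_vector_3:
  "vector [a, b, c] \<bullet> (vector [a', b', c'] :: real ^ 3) = a * a' + b * b' + c * c'"
  by (simp add: inner_vec_def sum_3)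

section \<open>The two distances to \<open>0\<close> and \<open>-1\<close>\<close>

lemma cmod_plus_1_sq: "cmod (z + 1) ^ 2 = cmod z ^ 2 + 2 * Re z + 1"
  unfolding cmod_power2 by (simp add: power2_eq_square algebra_simps)

text \<open>Heron's formula for the triangle with vertices \<open>0\<close>, \<open>-1\<close>,
  \<open>z\<close>: the side between \<open>0\<close> and \<open>-1\<close> has length 1 and the
  height over it is \<open>|Im z|\<close>, so both sides are 16 times the squared area.\<close>

lemma heron:
  "(cmod z - cmod (z + 1) + 1) * (cmod (z + 1) - cmod z + 1) * (cmod z + cmod (z + 1) - 1)
    * (1 + cmod z + cmod (z + 1)) = 4 * Im z ^ 2"
proof -
  define a b where "a = cmod z" and "b = cmod (z + 1)"
  have b: "b ^ 2 = a ^ 2 + 2 * Re z + 1" by (simp add: a_def b_def cmod_plus_1_sq)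
  have a: "a ^ 2 = Re z ^ 2 + Im z ^ 2" by (simp add: a_def cmod_power2)
  \<comment> \<open>The bracket \<open>b^2 - a^2 - 1\<close> equals \<open>2 * Re z\<close>, which
    leaves \<open>4 * (a^2 - (Re z)^2)\<close>.\<close>
  have "(a - b + 1) * (b - a + 1) * (a + b - 1) * (1 + a + b) = 4 * a ^ 2 - (b ^ 2 - a ^ 2 - 1) ^ 2"
    by algebra
  also have "\<dots> = 4 * Im z ^ 2" using a b by algebra
  finally show ?thesis by (simp add: a_def b_def)
qed

text \<open>The triangle inequalities give the weak versions; no factor can vanish because Heron's
  product is nonzero off the real line.\<close>

lemma triangle_strict:
  assumes "Im z \<noteq> 0"
  shows "0 < cmod z - cmod (z + 1) + 1" "0 < cmod (z + 1) - cmod z + 1"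
    "0 < cmod z + cmod (z + 1) - 1"
proof -
  have nn: "0 \<le> cmod z - cmod (z + 1) + 1" "0 \<le> cmod (z + 1) - cmod z + 1"
    "0 \<le> cmod z + cmod (z + 1) - 1"
    using norm_triangle_ineq[of z 1] norm_triangle_ineq4[of "z + 1" 1]
      norm_triangle_ineq4[of "z + 1" z] by auto
  have "(cmod z - cmod (z + 1) + 1) * (cmod (z + 1) - cmod z + 1) * (cmod z + cmod (z + 1) - 1)
    * (1 + cmod z + cmod (z + 1)) \<noteq> 0" unfolding heron using assms by simp
  then show "0 < cmod z - cmod (z + 1) + 1" "0 < cmod (z + 1) - cmod z + 1"
    "0 < cmod z + cmod (z + 1) - 1"
    using nn by (auto simp: less_le)
qed

lemma XYZ_pos:
  assumes "Im z \<noteq> 0"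
  shows "0 < X z" "0 < Y z" "0 < Z z"
  using triangle_strict[OF assms] unfolding X_def Y_def Z_def
  by (auto intro!: divide_pos_pos add_pos_nonneg)

lemma denom_pos: "0 < 1 + cmod z + cmod (z + 1)"
  by (simp add: add_pos_nonneg)

lemma denom_nonzero: "1 + cmod z + cmod (z + 1) \<noteq> 0"
  using denom_pos[of z] by linarith

lemma XYZ_sum: "X z + Y z + Z z = 1"
  using denom_nonzero[of z] unfolding X_def Y_def Z_def add_divide_distrib[symmetric]
  by (simp add: divide_eq_1_iff)

lemma sphere_map_in:
  assumes "Im z \<noteq> 0"
  shows "sphere_map z \<in> sphere 0 1 \<inter> positive_octant"
  using XYZ_pos[OF assms] XYZ_sum[of z]
  by (simp add: sphere_map_def positive_octant_def norm_eq_1 inner_vector_3)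

section \<open>The inverse map\<close>

text \<open>
  On the sphere this is \<open>((wy \<plusminus> \<i>x) / (x\<^sup>2 + y\<^sup>2))\<^sup>2\<close>, where \<open>(x, y, w)\<close> are the coordinates of \<open>p\<close>
  and the sign is \<open>e\<close>.
\<close>

definition plane_map :: "real \<Rightarrow> real ^ 3 \<Rightarrow> complex" where
  "plane_map e p = Complex
     (((p$3)\<^sup>2 * ((p$2)\<^sup>2 - (p$1)\<^sup>2) - (p$1)\<^sup>2 * ((p$1)\<^sup>2 + (p$2)\<^sup>2)) / ((p$1)\<^sup>2 + (p$2)\<^sup>2)\<^sup>2)
     (e * (2 * p$1 * p$2 * p$3) / ((p$1)\<^sup>2 + (p$2)\<^sup>2)\<^sup>2)"

text \<open>The open half-space contains the octant and avoids the zeros of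
  \<open>x^2 + y^2\<close>, so it carries the ambient extension that smoothness on the sphere asks
  for.\<close>

lemma C_infinity_on_plane_map: "C_infinity_on {p. 0 < p$1} (plane_map e)"
proof -
  have o: "open {p :: real ^ 3. 0 < p$1}"
    by (intro open_Collect_less continuous_intros)
  have c: "C_infinity_on {p. 0 < p$1} (\<lambda>p :: real ^ 3. p $ i)" for i
    by (rule C_infinity_on_linear[OF o bounded_linear_vec_nth])
  show ?thesis
    unfolding plane_map_def[abs_def]
    by (intro C_infinity_on_Complex C_infinity_on_divide C_infinity_on_mult C_infinity_on_diff
        C_infinity_on_add C_infinity_on_power C_infinity_on_const c o)
      (auto simp: sum_power2_eq_zero_iff)
qed

text \<open>Since \<open>X + Y = 2 / s\<close>, the denominators clear. The real part then follows
  from \<open>b^2 = a^2 + 2 * Re z + 1\<close>, and the imaginary part from Heron's formula up to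
  the sign \<open>e\<close>.\<close>

lemma plane_map_sphere_map:
  assumes "e = 1 \<or> e = -1" "0 < e * Im z"
  shows "plane_map e (sphere_map z) = z"
proof -
  have im: "Im z \<noteq> 0" using assms by auto
  define a b where "a = cmod z" and "b = cmod (z + 1)"
  define s where "s = 1 + a + b"
  note pos = XYZ_pos[OF im]
  have s: "s > 0" using denom_pos[of z] by (simp add: s_def a_def b_def)
  have X: "X z = (a - b + 1) / s" and Y: "Y z = (b - a + 1) / s" and Z: "Z z = (a + b - 1) / s"
    by (simp_all add: X_def Y_def Z_def s_def a_def b_def)
  have XY: "X z + Y z = 2 / s" using s unfolding X Y by (simp add: field_simps)
  have b: "b ^ 2 = a ^ 2 + 2 * Re z + 1" by (simp add: a_def b_def cmod_plus_1_sq)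
  have "Z z * (Y z - X z) - X z * (X z + Y z) = (2 * (a + b - 1) * (b - a) - 2 * (a - b + 1)) / s\<^sup>2"
    unfolding XY unfolding X Y Z using s by (simp add: field_simps power2_eq_square)
  also have "2 * (a + b - 1) * (b - a) - 2 * (a - b + 1) = 4 * Re z" using b by algebra
  finally have re: "(Z z * (Y z - X z) - X z * (X z + Y z)) / (X z + Y z)\<^sup>2 = Re z"
    unfolding XY using s by (simp add: field_simps)
  \<comment> \<open>Expanding the fraction by \<open>s\<close> completes the numerator to Heron's
    product.\<close>
  have "X z * Y z * Z z = (a - b + 1) * (b - a + 1) * (a + b - 1) * s / s ^ 4"
    unfolding X Y Z using s by (simp add: field_simps power4_eq_xxxx)
  also have "\<dots> = (2 * Im z / s\<^sup>2)\<^sup>2"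
    using heron[of z] by (simp add: a_def b_def s_def power_mult_distrib power_divide)
  also have "\<dots> = (e * (2 * Im z / s\<^sup>2))\<^sup>2" using assms(1) by auto
  finally have sq: "(e * (2 * Im z / s\<^sup>2))\<^sup>2 = X z * Y z * Z z" by (rule sym)
  \<comment> \<open>The half-plane condition selects the nonnegative one of the two square
    roots.\<close>
  have "0 \<le> 2 * (e * Im z) / s\<^sup>2" using assms(2) by simp
  then have "0 \<le> e * (2 * Im z / s\<^sup>2)" by (simp add: mult_ac)
  with sq have "sqrt (X z * Y z * Z z) = e * (2 * Im z / s\<^sup>2)" by (rule real_sqrt_unique)
  then have "e * (2 * sqrt (X z) * sqrt (Y z) * sqrt (Z z)) / (X z + Y z)\<^sup>2 = Im z"
    unfolding XY using s assms(1) by (auto simp: real_sqrt_mult field_simps)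
  then show ?thesis
    using re pos by (simp add: plane_map_def sphere_map_def complex_eq_iff)
qed

text \<open>Both squared distances turn out to be perfect squares, so that
  \<open>a = (x^2 + w^2) / t\<close>, \<open>b = (y^2 + w^2) / t\<close> and
  \<open>s = 2 / t\<close>; the coordinates can then be read off.\<close>

lemma sphere_map_plane_map:
  assumes "p \<in> sphere 0 1 \<inter> positive_octant" "e = 1 \<or> e = -1"
  shows "0 < e * Im (plane_map e p)" "sphere_map (plane_map e p) = p"
proof -
  define x y w where "x = p$1" and "y = p$2" and "w = p$3"
  have pos: "0 < x" "0 < y" "0 < w" using assms by (auto simp: positive_octant_def x_def y_def w_def)
  have sp: "x\<^sup>2 + y\<^sup>2 + w\<^sup>2 = 1"
    using assms by (simp add: norm_eq_1 inner_vec_def sum_3 x_def y_def w_def power2_eq_square)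
  define t where "t = x\<^sup>2 + y\<^sup>2"
  have t: "t > 0" using pos by (simp add: t_def add_pos_pos)
  have e: "e\<^sup>2 = 1" using assms by auto
  define z where "z = plane_map e p"
  have re: "Re z = (w\<^sup>2 * (y\<^sup>2 - x\<^sup>2) - x\<^sup>2 * t) / t\<^sup>2" and im: "Im z = e * (2 * x * y * w) / t\<^sup>2"
    by (simp_all add: z_def plane_map_def x_def y_def w_def t_def)
  have "e * Im z = e\<^sup>2 * ((2 * x * y * w) / t\<^sup>2)" unfolding im by (simp add: power2_eq_square)
  then show "0 < e * Im (plane_map e p)" using pos t e by (simp add: z_def)
  have "(cmod z)\<^sup>2 = ((w\<^sup>2 * (y\<^sup>2 - x\<^sup>2) - x\<^sup>2 * t)\<^sup>2 + e\<^sup>2 * (2 * x * y * w)\<^sup>2) / (t\<^sup>2)\<^sup>2"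
    unfolding cmod_power2 re im by (simp add: power_divide power_mult_distrib add_divide_distrib)
  \<comment> \<open>The left side is the squared modulus of the square of
    \<open>w*y + e*i*x\<close>, that is \<open>(w^2 * y^2 + x^2)^2\<close>, and on the sphere
    \<open>w^2 * y^2 + x^2 = (x^2 + w^2) * t\<close>.\<close>
  also have "(w\<^sup>2 * (y\<^sup>2 - x\<^sup>2) - x\<^sup>2 * t)\<^sup>2 + e\<^sup>2 * (2 * x * y * w)\<^sup>2 = ((x\<^sup>2 + w\<^sup>2) * t)\<^sup>2"
    unfolding e using sp t_def by algebra
  finally have "(cmod z)\<^sup>2 = ((x\<^sup>2 + w\<^sup>2) / t)\<^sup>2"
    using t by (simp add: power_mult_distrib power_divide power2_eq_square)
  then have a: "cmod z = (x\<^sup>2 + w\<^sup>2) / t"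
    using t by (subst (asm) power2_eq_iff_nonneg) auto
  have "(cmod (z + 1))\<^sup>2 = ((x\<^sup>2 + w\<^sup>2)\<^sup>2 + 2 * (w\<^sup>2 * (y\<^sup>2 - x\<^sup>2) - x\<^sup>2 * t) + t\<^sup>2) / t\<^sup>2"
    unfolding cmod_plus_1_sq a re using t by (simp add: field_simps)
  also have "(x\<^sup>2 + w\<^sup>2)\<^sup>2 + 2 * (w\<^sup>2 * (y\<^sup>2 - x\<^sup>2) - x\<^sup>2 * t) + t\<^sup>2 = (y\<^sup>2 + w\<^sup>2)\<^sup>2"
    unfolding t_def by algebra
  finally have "(cmod (z + 1))\<^sup>2 = ((y\<^sup>2 + w\<^sup>2) / t)\<^sup>2" by (simp add: power_divide)
  then have b: "cmod (z + 1) = (y\<^sup>2 + w\<^sup>2) / t"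
    using t by (subst (asm) power2_eq_iff_nonneg) auto
  have "1 + cmod z + cmod (z + 1) = (t + (x\<^sup>2 + w\<^sup>2) + (y\<^sup>2 + w\<^sup>2)) / t"
    unfolding a b add_divide_distrib using t by simp
  also have "t + (x\<^sup>2 + w\<^sup>2) + (y\<^sup>2 + w\<^sup>2) = 2" using sp by (simp add: t_def)
  finally have s: "1 + cmod z + cmod (z + 1) = 2 / t" .
  have frac: "u / t - v / t + 1 = (u - v + t) / t" "u / t + v / t - 1 = (u + v - t) / t" for u v
    using t by (simp_all add: add_divide_distrib diff_divide_distrib)
  have "cmod z - cmod (z + 1) + 1 = 2 * x\<^sup>2 / t" "cmod (z + 1) - cmod z + 1 = 2 * y\<^sup>2 / t"
    "cmod z + cmod (z + 1) - 1 = 2 * w\<^sup>2 / t"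
    unfolding a b frac by (simp_all add: t_def)
  then have "X z = x\<^sup>2" "Y z = y\<^sup>2" "Z z = w\<^sup>2"
    unfolding X_def Y_def Z_def s using t by simp_all
  then have "sphere_map z = vector [x, y, w]" using pos by (simp add: sphere_map_def)
  then show "sphere_map (plane_map e p) = p"
    by (simp add: z_def x_def y_def w_def vec_eq_iff forall_3)
qed

section \<open>Smoothness and the pulled back metric\<close>

lemma C_infinity_on_cmods:
  assumes "open U" "0 \<notin> U" "-1 \<notin> U"
  shows "C_infinity_on U cmod" "C_infinity_on U (\<lambda>z. cmod (z + 1))"
proof -
  have nz: "z + 1 \<noteq> 0" if "z \<in> U" for z using that assms(3) by (metis eq_neg_iff_add_eq_0)
  have l: "C_infinity_on U Re" "C_infinity_on U Im"
    by (intro C_infinity_on_linear assms bounded_linear_Re bounded_linear_Im)+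
  show "C_infinity_on U cmod"
    using C_infinity_on_cmod[of U "\<lambda>z. z"] l assms by auto
  have "C_infinity_on U (\<lambda>z. Re z + 1)"
    by (intro C_infinity_on_add l C_infinity_on_const assms)
  then show "C_infinity_on U (\<lambda>z. cmod (z + 1))"
    using nz l by (intro C_infinity_on_cmod) auto
qed

lemma riemannian_metric_g_metric: "riemannian_metric_on (UNIV - {0, -1}) g_metric"
proof -
  let ?U = "UNIV - {0, -1 :: complex}"
  have o: "open ?U" by (simp add: open_Diff finite_imp_closed)
  have pos: "0 < 2 * cmod z * cmod (z + 1) * (1 + cmod z + cmod (z + 1))" if "z \<in> ?U" for z
    using that denom_pos[of z] by (auto simp: eq_neg_iff_add_eq_0)
  have "bilinear (g_metric z)" for z
    unfolding bilinear_def g_metric_def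
    by (auto intro!: linearI simp: inner_add_left inner_add_right add_divide_distrib)
  moreover have "g_metric z v w = g_metric z w v" for z v w
    by (simp add: g_metric_def inner_commute)
  moreover have "0 < g_metric z v v" if "z \<in> ?U" "v \<noteq> 0" for z v
    unfolding g_metric_def using pos[OF that(1)] that(2) by (intro divide_pos_pos) auto
  moreover have "C_infinity_on ?U (\<lambda>z. g_metric z v w)" for v w
    unfolding g_metric_def
    by (intro C_infinity_on_divide C_infinity_on_mult C_infinity_on_add C_infinity_on_const
        C_infinity_on_cmods o) (use pos in \<open>auto simp: denom_nonzero eq_neg_iff_add_eq_0\<close>)
  ultimately show ?thesis unfolding riemannian_metric_on_def using o by auto
qed

lemma C_infinity_on_sphere_map:
  assumes "open U" "\<And>z. z \<in> U \<Longrightarrow> Im z \<noteq> 0"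
  shows "C_infinity_on U sphere_map"
proof -
  have n: "0 \<notin> U" "-1 \<notin> U" using assms(2) by fastforce+
  show ?thesis
    unfolding sphere_map_def[abs_def] X_def[abs_def] Y_def[abs_def] Z_def[abs_def]
    by (intro C_infinity_on_vector_3 C_infinity_on_sqrt C_infinity_on_divide C_infinity_on_add
        C_infinity_on_diff C_infinity_on_const C_infinity_on_cmods assms n)
      (use assms(2) XYZ_pos denom_nonzero in \<open>auto simp: X_def Y_def Z_def\<close>)
qed

section \<open>Computation of the pulled back metric\<close>

text \<open>Logarithmic differentiation: the derivative of \<open>sqrt F\<close> is
  \<open>sqrt F / 2\<close> times that of \<open>log F\<close>, so products of two such derivatives
  carry the root-free weight \<open>F / 4\<close>.\<close>

lemma sqrt_quotient_has_derivative:
  fixes f g :: "'a::real_normed_vector \<Rightarrow> real"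
  assumes "(f has_derivative f') (at z)" "(g has_derivative g') (at z)" "0 < f z" "0 < g z"
  shows "((\<lambda>z. sqrt (f z / g z)) has_derivative
    (\<lambda>v. sqrt (f z / g z) / 2 * (f' v / f z - g' v / g z))) (at z)"
proof -
  let ?r = "f z / g z"
  have r: "0 < ?r" using assms by simp
  have "((\<lambda>z. f z / g z) has_derivative (\<lambda>v. ?r * (f' v / f z - g' v / g z))) (at z)"
    using assms by (auto intro!: derivative_eq_intros simp: field_simps fun_eq_iff)
  note D = has_derivative_real_sqrt[OF r this]
  have "c * u * (inverse (sqrt c) / 2) = sqrt c / 2 * u" if "0 < c" for c u :: real
    using that by (simp add: field_simps)
  from this[OF r] show ?thesis using D by simp
qed

text \<open>
  The Gram identity for the vectors \<open>z\<close> and \<open>z + 1\<close>, whose determinant is \<open>\<plusminus>Im z\<close>.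
\<close>

lemma gram:
  fixes v w z :: complex
  shows "4 * ((cmod (z + 1))\<^sup>2 * (z \<bullet> v) * (z \<bullet> w) + (cmod z)\<^sup>2 * ((z + 1) \<bullet> v) * ((z + 1) \<bullet> w))
    - (2 * (cmod z)\<^sup>2 + 2 * (cmod (z + 1))\<^sup>2 - 2)
      * ((z \<bullet> v) * ((z + 1) \<bullet> w) + ((z + 1) \<bullet> v) * (z \<bullet> w))
    = 4 * (Im z)\<^sup>2 * (v \<bullet> w)"
  unfolding cmod_power2 inner_complex_def by simp algebra

text \<open>
  With \<open>\<alpha>, \<beta>\<close> the values of the differentials of the two distances \<open>a, b\<close>, both sides are
  compared after clearing the product of the denominators, which is \<open>4 (Im z)\<^sup>2\<close> by Heron's formula.
\<close>

lemma elliptic_identity: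
  fixes z v w :: complex
  assumes "Im z \<noteq> 0"
  defines "a \<equiv> cmod z" and "b \<equiv> cmod (z + 1)"
  defines "\<alpha> \<equiv> \<lambda>v. (z \<bullet> v) / a" and "\<beta> \<equiv> \<lambda>v. ((z + 1) \<bullet> v) / b"
  shows "(\<alpha> v - \<beta> v) * (\<alpha> w - \<beta> w) / ((a - b + 1) * (b - a + 1))
    + (\<alpha> v + \<beta> v) * (\<alpha> w + \<beta> w) / ((a + b - 1) * (1 + a + b)) = (v \<bullet> w) / (a * b)"
proof -
  define D E where "D = (a - b + 1) * (b - a + 1)" and "E = (a + b - 1) * (1 + a + b)"
  have "z \<noteq> 0" "z + 1 \<noteq> 0" using assms(1) by (auto simp: complex_eq_iff)
  then have ab: "a > 0" "b > 0" by (auto simp: a_def b_def)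
  have DE: "D > 0" "E > 0"
    using triangle_strict[OF assms(1)] denom_pos[of z] by (simp_all add: D_def E_def a_def b_def)
  have DE4: "D * E = 4 * (Im z)\<^sup>2"
    using heron[of z] by (simp add: D_def E_def a_def b_def mult_ac)
  have P: "z \<bullet> u = a * \<alpha> u" and Q: "(z + 1) \<bullet> u = b * \<beta> u" for u
    using ab by (simp_all add: \<alpha>_def \<beta>_def)
  \<comment> \<open>Here \<open>D + E = 4 * a * b\<close> gives the pure terms and
    \<open>D - E = 2 - 2 * a^2 - 2 * b^2\<close> the mixed terms of the Gram identity.\<close>
  have "a * b * (E * ((\<alpha> v - \<beta> v) * (\<alpha> w - \<beta> w)) + D * ((\<alpha> v + \<beta> v) * (\<alpha> w + \<beta> w)))
    = 4 * (b\<^sup>2 * (a * \<alpha> v) * (a * \<alpha> w) + a\<^sup>2 * (b * \<beta> v) * (b * \<beta> w))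
      - (2 * a\<^sup>2 + 2 * b\<^sup>2 - 2) * (a * \<alpha> v * (b * \<beta> w) + b * \<beta> v * (a * \<alpha> w))"
    unfolding D_def E_def by algebra
  also have "\<dots> = D * E * (v \<bullet> w)"
    using gram[of z v w] unfolding P Q DE4 by (simp add: a_def b_def)
  finally show ?thesis
    using ab DE unfolding D_def[symmetric] E_def[symmetric] by (simp add: field_simps)
qed

text \<open>
  Here \<open>p / s, q / s, r / s\<close> play the role of \<open>X, Y, Z\<close>, and \<open>d, -d, m, m\<close> are the derivatives of
  \<open>p, q, r, s\<close> in one direction, \<open>d', -d', m', m'\<close> those in another.
\<close>

lemma log_derivative_sum:
  fixes p q r s :: real
  assumes nz: "p \<noteq> 0" "q \<noteq> 0" "r \<noteq> 0" "s \<noteq> 0" and rel: "p + q = 2" "s = r + 2"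
  shows "(p / s * ((d / p - m / s) * (d' / p - m' / s))
      + q / s * ((- d / q - m / s) * (- d' / q - m' / s))
      + r / s * ((m / r - m / s) * (m' / r - m' / s))) / 4
    = (d * d' / (p * q) + m * m' / (r * s)) / (2 * s)"
proof -
  have 1: "p / s * ((d / p - m / s) * (d' / p - m' / s))
    = (d * d' / p - (d * m' + d' * m) / s + p * (m * m') / s\<^sup>2) / s"
    using nz by (simp add: field_simps power2_eq_square)
  have 2: "q / s * ((- d / q - m / s) * (- d' / q - m' / s))
    = (d * d' / q + (d * m' + d' * m) / s + q * (m * m') / s\<^sup>2) / s"
    using nz by (simp add: field_simps power2_eq_square)
  have 3: "r / s * ((m / r - m / s) * (m' / r - m' / s))
    = (m * m' / r - 2 * (m * m') / s + r * (m * m') / s\<^sup>2) / s"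
    using nz by (simp add: field_simps power2_eq_square)
  have 4: "d * d' / p + d * d' / q = 2 * (d * d' / (p * q))"
    using nz rel(1) by (simp add: field_simps) algebra
  have 5: "p * (m * m') / s\<^sup>2 + q * (m * m') / s\<^sup>2 + (m * m' / r - 2 * (m * m') / s
    + r * (m * m') / s\<^sup>2) = 2 * (m * m' / (r * s))"
  proof -
    have expand: "p * M / s\<^sup>2 + q * M / s\<^sup>2 + (M / r - 2 * M / s + r * M / s\<^sup>2)
      = (p + q + r) * M / s\<^sup>2 + M / r - 2 * M / s" for M
      by (simp add: add_divide_distrib distrib_right)
    have sums: "p + q + r = s" "s - r = 2" using rel by simp_all
    have "s * M / s\<^sup>2 + M / r - 2 * M / s = (s - r) * (M / (r * s))" for M
      using nz by (simp add: field_simps power2_eq_square)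
    from this[of "m * m'"] show ?thesis using expand[of "m * m'"] unfolding sums by linarith
  qed
  \<comment> \<open>The mixed terms \<open>c\<close> in \<open>d\<close> and \<open>m\<close> have
    opposite signs in \<open>1\<close> and \<open>2\<close> and cancel; \<open>4\<close> and
    \<open>5\<close> then evaluate the remaining \<open>d\<close> and \<open>m\<close>
    parts.\<close>
  have collect: "((P - c + P') / s + (Q + c + Q') / s + R / s) / 4
    = (P + Q + (P' + Q' + R)) / s / 4" for P P' c Q Q' R
    by (simp add: add_divide_distrib diff_divide_distrib)
  show ?thesis unfolding 1 2 3 collect 4 5 by (simp add: add_divide_distrib mult_ac)
qed

text \<open>The computation is carried out for two vectors \<open>v\<close>, \<open>w\<close>, thus
  directly for the bilinear form: \<open>log_derivative_sum\<close> separates the parts in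
  \<open>\<alpha> - \<beta>\<close> and \<open>\<alpha> + \<beta>\<close>, and
  \<open>elliptic_identity\<close> recombines them into \<open>v \<bullet> w\<close>.\<close>

lemma pullback_sphere_map:
  assumes "Im z \<noteq> 0"
  shows "pullback_metric sphere_map induced_metric z v w = g_metric z v w"
proof -
  define a b where "a = cmod z" and "b = cmod (z + 1)"
  define \<alpha> \<beta> where "\<alpha> = (\<lambda>v. (z \<bullet> v) / a)" and "\<beta> = (\<lambda>v. ((z + 1) \<bullet> v) / b)"
  define s where "s = 1 + a + b"
  have nz: "z \<noteq> 0" "z + 1 \<noteq> 0" using assms(1) by (auto simp: complex_eq_iff)
  note tri = triangle_strict[OF assms, folded a_def b_def]
  note pos = XYZ_pos[OF assms]
  have s: "0 < s" using denom_pos[of z] by (simp add: s_def a_def b_def)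
  have Da: "(cmod has_derivative \<alpha>) (at z)"
    using has_derivative_norm[OF nz(1)] unfolding \<alpha>_def a_def
    by (simp add: sgn_div_norm inner_commute divide_inverse_commute)
  have Db: "((\<lambda>z. cmod (z + 1)) has_derivative \<beta>) (at z)"
    using has_derivative_compose[of "\<lambda>z. z + 1" "\<lambda>v. v", OF _ has_derivative_norm[OF nz(2)]]
    unfolding \<beta>_def b_def
    by (simp add: sgn_div_norm inner_commute divide_inverse_commute has_derivative_add_const)
  \<comment> \<open>These are the differentials at \<open>z\<close> of the logarithms of
    \<open>X\<close>, \<open>Y\<close> and \<open>Z\<close>.\<close>
  define A B C where "A = (\<lambda>v. (\<alpha> v - \<beta> v) / (a - b + 1) - (\<alpha> v + \<beta> v) / s)"
    and "B = (\<lambda>v. (\<beta> v - \<alpha> v) / (b - a + 1) - (\<alpha> v + \<beta> v) / s)"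
    and "C = (\<lambda>v. (\<alpha> v + \<beta> v) / (a + b - 1) - (\<alpha> v + \<beta> v) / s)"
  have Ds: "((\<lambda>z. 1 + cmod z + cmod (z + 1)) has_derivative (\<lambda>v. \<alpha> v + \<beta> v)) (at z)"
    by (auto intro!: derivative_eq_intros Da Db)
  have DX: "((\<lambda>z. sqrt (X z)) has_derivative (\<lambda>v. sqrt (X z) / 2 * A v)) (at z)"
    unfolding X_def A_def s_def a_def b_def
    by (rule sqrt_quotient_has_derivative[OF _ Ds _ denom_pos])
      (use tri in \<open>auto intro!: derivative_eq_intros Da Db simp: a_def b_def\<close>)
  have DY: "((\<lambda>z. sqrt (Y z)) has_derivative (\<lambda>v. sqrt (Y z) / 2 * B v)) (at z)"
    unfolding Y_def B_def s_def a_def b_def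
    by (rule sqrt_quotient_has_derivative[OF _ Ds _ denom_pos])
      (use tri in \<open>auto intro!: derivative_eq_intros Da Db simp: a_def b_def\<close>)
  have DZ: "((\<lambda>z. sqrt (Z z)) has_derivative (\<lambda>v. sqrt (Z z) / 2 * C v)) (at z)"
    unfolding Z_def C_def s_def a_def b_def
    by (rule sqrt_quotient_has_derivative[OF _ Ds _ denom_pos])
      (use tri in \<open>auto intro!: derivative_eq_intros Da Db simp: a_def b_def\<close>)
  have "(sphere_map has_derivative
      (\<lambda>v. vector [sqrt (X z) / 2 * A v, sqrt (Y z) / 2 * B v, sqrt (Z z) / 2 * C v])) (at z)"
    unfolding sphere_map_def[abs_def] vector_3_expand
    by (intro has_derivative_add has_derivative_scaleR_left DX DY DZ)
  then have "pullback_metric sphere_map induced_metric z v w =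
      sqrt (X z) / 2 * A v * (sqrt (X z) / 2 * A w) + sqrt (Y z) / 2 * B v * (sqrt (Y z) / 2 * B w)
      + sqrt (Z z) / 2 * C v * (sqrt (Z z) / 2 * C w)"
    by (simp add: pullback_metric_def induced_metric_def inner_vector_3
        frechet_derivative_at[symmetric])
  also have "\<dots> = (X z * (A v * A w) + Y z * (B v * B w) + Z z * (C v * C w)) / 4"
  proof -
    have "sqrt r / 2 * p * (sqrt r / 2 * q) = r * (p * q) / 4" if "0 < r" for r p q :: real
      using that by (simp add: field_simps)
    note this[OF pos(1)] this[OF pos(2)] this[OF pos(3)]
    then show ?thesis by (simp only: add_divide_distrib)
  qed
  also have "\<dots> = ((\<alpha> v - \<beta> v) * (\<alpha> w - \<beta> w) / ((a - b + 1) * (b - a + 1))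
    + (\<alpha> v + \<beta> v) * (\<alpha> w + \<beta> w) / ((a + b - 1) * s)) / (2 * s)"
  proof -
    define p q r where "p = a - b + 1" and "q = b - a + 1" and "r = a + b - 1"
    have XYZ: "X z = p / s" "Y z = q / s" "Z z = r / s"
      by (simp_all add: X_def Y_def Z_def p_def q_def r_def s_def a_def b_def)
    have nz': "p \<noteq> 0" "q \<noteq> 0" "r \<noteq> 0" "s \<noteq> 0" using tri s by (auto simp: p_def q_def r_def)
    have rel: "p + q = 2" "s = r + 2" by (auto simp: p_def q_def r_def s_def)
    from log_derivative_sum[OF nz' rel, of "\<alpha> v - \<beta> v" "\<alpha> v + \<beta> v" "\<alpha> w - \<beta> w" "\<alpha> w + \<beta> w"]
    show ?thesis unfolding A_def B_def C_def XYZ p_def[symmetric] q_def[symmetric] r_def[symmetric]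
      by (simp only: minus_diff_eq)
  qed
  also have "\<dots> = (v \<bullet> w) / (a * b) / (2 * s)"
    using elliptic_identity[OF assms, of v w]
    unfolding a_def[symmetric] b_def[symmetric] s_def \<alpha>_def \<beta>_def by simp
  also have "\<dots> = g_metric z v w"
    by (simp add: g_metric_def a_def b_def s_def mult_ac)
  finally show ?thesis .
qed

section \<open>Assembly of the isometric diffeomorphisms\<close>

lemma smooth_map_onI:
  assumes "C_infinity_on W h" "S \<subseteq> W" "\<And>y. y \<in> S \<Longrightarrow> h y = f y"
  shows "smooth_map_on S f"
  unfolding smooth_map_on_def
  by (intro ballI exI[of _ W] exI[of _ h]) (use assms in auto)

text \<open>The sign \<open>e\<close> treats both half-planes at once. \<open>sphere_map\<close> is
  smooth on the open half-plane itself, and its inverse extends smoothly off the sphere as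
  \<open>plane_map e\<close>.\<close>

lemma isometric_half_plane:
  assumes e: "e = 1 \<or> e = -1"
  shows "isometric_diffeomorphism {z. 0 < e * Im z} g_metric
    (sphere 0 1 \<inter> positive_octant) induced_metric sphere_map"
proof -
  let ?S = "{z. 0 < e * Im z}" and ?T = "sphere 0 1 \<inter> positive_octant"
  have o: "open ?S" by (intro open_Collect_less continuous_intros)
  have im: "Im z \<noteq> 0" if "z \<in> ?S" for z using that by auto
  have bij: "bij_betw sphere_map ?S ?T"
    by (rule bij_betw_byWitness[where f' = "plane_map e"])
      (use plane_map_sphere_map[OF e] sphere_map_plane_map[OF _ e] sphere_map_in im in auto)
  have inv: "inv_into ?S sphere_map p = plane_map e p" if "p \<in> ?T" for p
    using that bij sphere_map_plane_map[OF that e] by (auto simp: bij_betw_def intro!: inv_into_f_eq)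
  have "smooth_map_on ?S sphere_map"
    by (rule smooth_map_onI[OF C_infinity_on_sphere_map[OF o im]]) auto
  moreover have "smooth_map_on ?T (inv_into ?S sphere_map)"
    by (rule smooth_map_onI[OF C_infinity_on_plane_map[of e]])
      (use inv in \<open>auto simp: positive_octant_def\<close>)
  ultimately show ?thesis
    unfolding isometric_diffeomorphism_def diffeomorphism_onto_def
    using o bij pullback_sphere_map[OF im] by simp
qed

theorem mainTheorem5:
  shows "riemannian_metric_on (UNIV - {0, -1}) g_metric \<and>
    isometric_diffeomorphism {z. 0 < Im z} g_metric
      (sphere 0 1 \<inter> positive_octant) induced_metric sphere_map \<and>
    isometric_diffeomorphism {z. Im z < 0} g_metric
      (sphere 0 1 \<inter> positive_octant) induced_metric sphere_map"
  using riemannian_metric_g_metric isometric_half_plane[of 1] isometric_half_plane[of "-1"] by simp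

end
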